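(* For any $p>1$, the function \[ x\mapsto \frac{1}{x^{p}}\,\omega_p\!\left(\frac1x\right) \] (with its value at $x=0$ understood as the limit for $x\to0_+$) is absolutely monotonic on $[0,1]$. Moreover, for all $x\in(0,1]$, we have the convergent expansion \[ \frac{1}{x^{p}}\,\omega_p\!\left(\frac1x\right)=\sum_{k=0}^{\infty}m_{2k}^{(p)}x^{2k} \] with coefficients \[ m_{2k}^{(p)}:=\int_{-1}^{1}t^{2k}\rho_p(|t|)\,dt>0 \] for all $k\in\mathbb{N}_0$.
   Context: Let $p>1$ and let $q>1$ be the Hölder conjugate index, $1/p+1/q=1$. For $\alpha>0$ the power of a complex number is taken in the principal branch: $z^{\alpha}:=|z|^{\alpha}e^{i\alpha\operatorname{Arg} z}$ with $\operatorname{Arg} z\in(-\pi,\pi]$ (and $0^\alpha=0$). $\mathbb{N}_0=\{0,1,2,\dots\}$. The optimal discrete $p$-Hardy weight is \[ \omega_p(n):=\left(1-\left(1-\frac1n\right)^{1/q}\right)^{p-1}-\left(\left(1+\frac1n\right)^{1/q}-1\right)^{p-1}, \] and the same expression defines $\omega_p$ at real arguments $n\ge1$, so that for $x\in(0,1]$ \[ \omega_p\!\left(\frac1x\right)=\left(1-(1-x)^{1/q}\right)^{p-1}-\left((1+x)^{1/q}-1\right)^{p-1}. \] The function $\rho_p$ is defined for $x\in(0,1]$ by \[ \rho_p(x):=-\frac1\pi\,x^{p-1}\operatorname{Im}\left[\left(1-e^{i\pi/q}\left(\frac1x-1\right)^{1/q}\right)^{p-1}\right], \] and its value at $0$ is understood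 as the limit of $\rho_p(x)$ for $x\to0_+$ (this limit is $\rho_p(0)=0$). A real-valued function $g$ is called absolutely monotonic on $[0,1]$ if it is continuous on $[0,1]$, infinitely differentiable on $(0,1)$, and $g^{(n)}(x)\ge0$ for all $x\in(0,1)$ and all $n\in\mathbb{N}_0$. *)

theory Defs
  imports "HOL-Analysis.Analysis"
begin

text \<open>
  In all definitions, \<open>q\<close> is meant to be the Hoelder conjugate index of \<open>p\<close>. On the type
  \<^typ>\<open>complex\<close>, \<^const>\<open>powr\<close> is the power in the principal branch, with argument in
  $(-\pi,\pi]$, and it satisfies \<open>0 powr \<alpha> = 0\<close>.
\<close>

definition hardy_weight :: "real \<Rightarrow> real \<Rightarrow> real \<Rightarrow> real" where
  "hardy_weight p q y =
     (1 - (1 - 1 / y) powr (1 / q)) powr (p - 1) -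
     ((1 + 1 / y) powr (1 / q) - 1) powr (p - 1)"

definition limit_at_zero :: "(real \<Rightarrow> real) \<Rightarrow> real \<Rightarrow> real" where
  "limit_at_zero f x = (if x = 0 then Lim (at_right 0) f else f x)"

definition scaled_weight :: "real \<Rightarrow> real \<Rightarrow> real \<Rightarrow> real" where
  "scaled_weight p q = limit_at_zero (\<lambda>x. 1 / x powr p * hardy_weight p q (1 / x))"

definition rho :: "real \<Rightarrow> real \<Rightarrow> real \<Rightarrow> real" where
  "rho p q = limit_at_zero (\<lambda>x.
     - (1 / pi) * x powr (p - 1) *
     Im ((1 - exp (\<i> * of_real pi / of_real q) * of_real ((1 / x - 1) powr (1 / q)))
           powr of_real (p - 1)))"

definition moment :: "real \<Rightarrow> real \<Rightarrow> nat \<Rightarrow> real" where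
  "moment p q n = (LINT t:{-1..1}|lborel. t ^ n * rho p q \<bar>t\<bar>)"

text \<open>
  At points of the open interval the iterated \<^const>\<open>deriv\<close> depends only on the values of
  \<open>g\<close> near the point, so the values of \<open>g\<close> outside $[0,1]$ are irrelevant.
\<close>

definition absolutely_monotonic_01 :: "(real \<Rightarrow> real) \<Rightarrow> bool" where
  "absolutely_monotonic_01 g \<longleftrightarrow>
     continuous_on {0..1} g \<and>
     (\<forall>n. \<forall>x\<in>{0<..<1}. (deriv ^^ n) g field_differentiable at x) \<and>
     (\<forall>n. \<forall>x\<in>{0<..<1}. (deriv ^^ n) g x \<ge> 0)"

end

theory Submission
  imports Defs "HOL-Complex_Analysis.Complex_Analysis" "HOL-Real_Asymp.Real_Asymp"
begin

text \<open>
  Put \<open>s = 1 / q\<close>, \<open>a = p - 1\<close> and \<open>H z = ((1 - (1 - z) powr s) / z) powr a\<close>. Then the scaled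
  weight is \<open>(H x - H (- x)) / x\<close>, i.e. twice the odd part of the Taylor series of \<open>H\<close>, divided by
  \<open>x\<close>. The base of \<open>H\<close> avoids the closed negative axis, so \<open>H\<close> is holomorphic on the plane cut
  along $[1,\infty)$, and it vanishes at infinity. Pushing the contour in Cauchy's coefficient formula to
  the cut and substituting \<open>t = 1 / z\<close> expresses the \<open>n\<close>-th coefficient, \<open>n \<ge> 1\<close>, as the integral
  of \<open>t ^ (n - 1) * rho p q t\<close> over $[0,1]$, because \<open>rho\<close> is the jump
  of \<open>H\<close> across the cut divided by $2 \pi i$, up to sign. Positivity
  of \<open>rho\<close> is a computation of arguments. To stay with a convex domain, the contour is moved in the
  coordinate \<open>w = Ln z\<close>, where the lower half-plane becomes the strip \<open>- pi \<le> Im w \<le> 0\<close>.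
\<close>

subsection \<open>Cauchy's theorem on rectangles and boundary values of powers\<close>

lemma has_contour_integral_linepath_same_Im:
  assumes "x1 < x2" and int: "(\<lambda>x. f (Complex x c)) integrable_on {x1..x2}"
  shows "(f has_contour_integral integral {x1..x2} (\<lambda>x. f (Complex x c)))
           (linepath (Complex x1 c) (Complex x2 c))"
proof -
  have "((\<lambda>w. f (w + \<i> * of_real c)) has_contour_integral integral {x1..x2} (\<lambda>x. f (Complex x c)))
          (linepath (of_real x1) (of_real x2))"
    using assms by (subst has_contour_integral_linepath_Reals_iff)
      (simp_all add: integrable_integral Complex_eq)
  moreover have "linepath (of_real x1) (of_real x2) t + \<i> * of_real c
      = linepath (Complex x1 c) (Complex x2 c) t" for t
    by (simp add: linepath_def complex_eq_iff algebra_simps)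
  moreover have "complex_of_real x2 - of_real x1 = Complex x2 c - Complex x1 c"
    by (simp add: complex_eq_iff)
  ultimately show ?thesis
    by (simp only: has_contour_integral_linepath)
qed

text \<open>Holomorphy is asked for in the open rectangle only: the horizontal edges will lie on the
  boundary of the strip, where just continuity is established. The two edges that the contour runs
  backwards stand on the right-hand side.\<close>

lemma Cauchy_rectangle:
  assumes cont: "continuous_on (cbox (Complex x1 y1) (Complex x2 y2)) f"
    and hol: "f holomorphic_on box (Complex x1 y1) (Complex x2 y2)"
    and "x1 < x2" "y1 < y2"
  shows "integral {x1..x2} (\<lambda>x. f (Complex x y1)) + \<i> * integral {y1..y2} (\<lambda>y. f (Complex x2 y))
       = integral {x1..x2} (\<lambda>x. f (Complex x y2)) + \<i> * integral {y1..y2} (\<lambda>y. f (Complex x1 y))"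
proof -
  let ?B = "cbox (Complex x1 y1) (Complex x2 y2)"
  have h: "(f has_contour_integral integral {x1..x2} (\<lambda>x. f (Complex x y)))
      (linepath (Complex x1 y) (Complex x2 y))" if "y \<in> {y1..y2}" for y
    using that assms
    by (intro has_contour_integral_linepath_same_Im integrable_continuous_interval
        continuous_on_compose2[OF cont] continuous_intros)
      (auto simp: in_cbox_complex_iff Complex_eq)
  have v: "(f has_contour_integral \<i> * integral {y1..y2} (\<lambda>y. f (Complex x y)))
      (linepath (Complex x y1) (Complex x y2))" if "x \<in> {x1..x2}" for x
  proof (subst has_contour_integral_linepath_same_Re_iff)
    have "(\<lambda>y. f (Complex x y)) integrable_on {y1..y2}"
      using that assms
      by (intro integrable_continuous_interval continuous_on_compose2[OF cont])
        (auto simp: in_cbox_complex_iff Complex_eq intro!: continuous_intros)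
    then show "((\<lambda>y. f (Complex x y)) has_integral
        - \<i> * (\<i> * integral {y1..y2} (\<lambda>y. f (Complex x y)))) {y1..y2}"
      by (simp add: integrable_integral flip: mult.assoc)
  qed (use assms in auto)
  have "(f has_contour_integral
      integral {x1..x2} (\<lambda>x. f (Complex x y1)) +
      (\<i> * integral {y1..y2} (\<lambda>y. f (Complex x2 y)) +
      (- integral {x1..x2} (\<lambda>x. f (Complex x y2)) +
       - (\<i> * integral {y1..y2} (\<lambda>y. f (Complex x1 y))))))
      (rectpath (Complex x1 y1) (Complex x2 y2))"
    unfolding rectpath_def Let_def complex.sel
    using assms(3,4)
    by (intro has_contour_integral_join h v)
      (auto intro!: has_contour_integral_reversepath[OF _ h, simplified]
        has_contour_integral_reversepath[OF _ v, simplified])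
  moreover have "(f has_contour_integral 0) (rectpath (Complex x1 y1) (Complex x2 y2))"
  proof (rule Cauchy_theorem_convex[OF cont, where K = "{}"])
    show "path_image (rectpath (Complex x1 y1) (Complex x2 y2)) \<subseteq> ?B"
      using assms by (intro path_image_rectpath_subset_cbox) auto
    show "f field_differentiable at z" if "z \<in> interior ?B - {}" for z
      using that hol by (simp add: interior_cbox holomorphic_on_imp_differentiable_at[OF _ open_box])
  qed auto
  ultimately show ?thesis
    using has_contour_integral_unique by (fastforce simp: algebra_simps)
qed

text \<open>The principal argument lies in (0, pi], and multiplying it by s in (0, 1) leads into (0,
  pi). The negative axis is included because its principal argument is pi.\<close>

lemma Im_powr_pos:
  fixes z :: complex
  assumes "0 < s" "s < 1" "0 < Im z \<or> Im z = 0 \<and> Re z < 0"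
  shows "0 < Im (z powr of_real s)"
proof -
  have "z \<noteq> 0" using assms by auto
  have "0 < Im (Ln z)" "Im (Ln z) \<le> pi"
    using assms(3) Im_Ln_pos_lt_imp[of z] Im_Ln_eq_pi[OF \<open>z \<noteq> 0\<close>] pi_gt_zero by force+
  moreover from this have "s * Im (Ln z) < 1 * Im (Ln z)"
    using assms by (intro mult_strict_right_mono) auto
  ultimately have "s * Im (Ln z) < pi" by linarith
  with \<open>0 < Im (Ln z)\<close> show ?thesis
    using \<open>z \<noteq> 0\<close> assms by (auto simp: powr_def Im_exp intro!: mult_pos_pos sin_gt_zero)
qed

text \<open>Rotating the closed upper half-plane to the closed right one shows that the principal power
  is continuous up to the negative axis from above.\<close>

lemma powr_eq_rotated:
  fixes z :: complex
  assumes "0 \<le> Im z"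
  shows "z powr w = exp (\<i> * of_real pi / 2 * w) * (- \<i> * z) powr w"
proof (cases "z = 0")
  case False
  have "Ln (- \<i> * z) = Ln z - \<i> * of_real pi / 2"
  proof (rule Ln_unique)
    show "exp (Ln z - \<i> * of_real pi / 2) = - \<i> * z"
      using False by (simp add: exp_diff exp_eq_polar[of "\<i> * of_real pi / 2"] cis_pi_half)
  qed (use Im_Ln_pos_le[OF False] assms pi_gt_zero in \<open>auto simp: field_simps add_pos_nonneg intro: less_le_trans[of _ 0]\<close>)
  then have "w * Ln z = \<i> * of_real pi / 2 * w + w * Ln (- \<i> * z)"
    by (simp add: right_diff_distrib)
  then show ?thesis
    using False by (simp add: powr_def flip: exp_add)
qed auto

lemma continuous_on_powr_upper_halfplane:
  assumes "0 < s"
  shows "continuous_on {z. 0 \<le> Im z} (\<lambda>z. z powr complex_of_real s)"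
proof -
  have "continuous_on {z. 0 \<le> Im z}
      (\<lambda>z. exp (\<i> * of_real pi / 2 * of_real s) * (- \<i> * z) powr complex_of_real s)"
    using assms by (intro continuous_intros) auto
  then show ?thesis
    by (rule continuous_on_eq) (simp add: powr_eq_rotated)
qed

subsection \<open>The generating function on the cut plane\<close>

text \<open>The value s at 0 is the derivative of 1 - (1 - z) powr s there, so the singularity is
  removed.\<close>

definition powr_quotient :: "real \<Rightarrow> complex \<Rightarrow> complex" where
  "powr_quotient s z = (if z = 0 then of_real s else (1 - (1 - z) powr of_real s) / z)"

lemma powr_quotient_of_real:
  "x \<le> 1 \<Longrightarrow> powr_quotient s (of_real x) = of_real (if x = 0 then s else (1 - (1 - x) powr s) / x)"
  using powr_of_real[of "1 - x" s] by (simp add: powr_quotient_def)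

lemma powr_quotient_real_pos:
  fixes x :: real
  assumes "0 < s" "x \<noteq> 0" "x \<le> 1"
  shows "0 < (1 - (1 - x) powr s) / x"
proof (cases "x > 0")
  case True
  then have "(1 - x) powr s < 1 powr s"
    using assms by (intro powr_less_mono2) auto
  with True show ?thesis by simp
next
  case False
  then have "1 powr s < (1 - x) powr s"
    using assms by (intro powr_less_mono2) auto
  with False assms show ?thesis by (simp add: divide_neg_neg)
qed

lemma powr_quotient_cnj:
  assumes "Im z \<noteq> 0 \<or> Re z \<le> 1"
  shows "powr_quotient s (cnj z) = cnj (powr_quotient s z)"
  using assms cnj_powr[of "1 - z" "of_real s"] by (auto simp: powr_quotient_def)

text \<open>On the real ray z <= 1 the quotient is positive. Elsewhere a quotient l <= 0 would give
  1 - (1 - z) powr s = l * z, where the left side has negative and the right side nonnegative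
  imaginary part. The cut is covered too: there 1 - z is negative, and its principal power is the
  limit from below the cut.\<close>

lemma powr_quotient_notin_nonpos_lower:
  assumes s: "0 < s" "s < 1" and z: "Im z \<le> 0"
  shows "powr_quotient s z \<notin> \<real>\<^sub>\<le>\<^sub>0"
proof (cases "Im z = 0 \<and> Re z \<le> 1")
  case True
  then have "z = of_real (Re z)" by (simp add: complex_eq_iff)
  moreover have "powr_quotient s (of_real (Re z)) \<notin> \<real>\<^sub>\<le>\<^sub>0"
    using True powr_quotient_real_pos[of s "Re z"] s
    by (auto simp: powr_quotient_of_real not_le)
  ultimately show ?thesis by simp
next
  case False
  then have "z \<noteq> 0" by auto
  have im: "0 < Im ((1 - z) powr of_real s)"
    using s z False by (intro Im_powr_pos) auto
  show ?thesis
  proof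
    assume "powr_quotient s z \<in> \<real>\<^sub>\<le>\<^sub>0"
    then obtain l where l: "l \<le> 0" "powr_quotient s z = of_real l"
      by (auto elim!: nonpos_Reals_cases)
    then have "1 - (1 - z) powr of_real s = of_real l * z"
      using \<open>z \<noteq> 0\<close> by (simp add: powr_quotient_def field_simps)
    then have "- Im ((1 - z) powr of_real s) = l * Im z"
      by (auto simp: complex_eq_iff)
    moreover have "l * Im z \<ge> 0" using l z by (simp add: mult_nonpos_nonpos)
    ultimately show False using im by linarith
  qed
qed

text \<open>Conjugation carries the result over to the upper half. The disc avoids the cut, where
  \<open>powr_quotient\<close> does not commute with conjugation.\<close>

lemma powr_quotient_notin_nonpos_ball:
  assumes s: "0 < s" "s < 1" and z: "norm z < 1"
  shows "powr_quotient s z \<notin> \<real>\<^sub>\<le>\<^sub>0"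
proof (cases "Im z \<le> 0")
  case False
  then have "powr_quotient s (cnj z) \<notin> \<real>\<^sub>\<le>\<^sub>0"
    using s by (intro powr_quotient_notin_nonpos_lower) auto
  then show ?thesis
    using False by (simp add: powr_quotient_cnj complex_nonpos_Reals_iff)
qed (use powr_quotient_notin_nonpos_lower s in blast)

lemma powr_quotient_holomorphic:
  assumes "open S" "\<And>z. z \<in> S \<Longrightarrow> 1 - z \<notin> \<real>\<^sub>\<le>\<^sub>0"
  shows "powr_quotient s holomorphic_on S"
proof (rule pole_theorem_open_0[where a = 0 and g = "\<lambda>z. 1 - (1 - z) powr of_real s"])
  show "(\<lambda>z. 1 - (1 - z) powr of_real s) holomorphic_on S"
    using assms by (intro holomorphic_intros) auto
  have "((\<lambda>z. z powr of_real s) has_field_derivative of_real s * (1 - 0) powr (of_real s - 1))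
      (at (1 - 0 :: complex))"
    by (rule has_field_derivative_powr) simp
  from DERIV_diff[OF DERIV_const[of 1] DERIV_chain2[OF this DERIV_diff[OF DERIV_const DERIV_ident]]]
  have "((\<lambda>z. 1 - (1 - z) powr of_real s) has_field_derivative of_real s) (at (0 :: complex))"
    by simp
  then show "powr_quotient s 0 = deriv (\<lambda>z. 1 - (1 - z) powr of_real s) 0"
    by (simp add: DERIV_imp_deriv powr_quotient_def)
qed (auto simp: assms powr_quotient_def)

text \<open>The map z -> 1 - z sends the closed lower half-plane to the closed upper one, where the
  principal power is continuous up to the boundary.\<close>

lemma powr_quotient_continuous_lower:
  assumes "0 < s"
  shows "continuous_on ({z. Im z \<le> 0} - {0}) (powr_quotient s)"
proof -
  have "continuous_on ({z. Im z \<le> 0} - {0}) (\<lambda>z. (1 - z) powr complex_of_real s)"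
    by (intro continuous_on_compose2[OF continuous_on_powr_upper_halfplane[OF assms], of _ "\<lambda>z. 1 - z"]
        continuous_intros) auto
  then have "continuous_on ({z. Im z \<le> 0} - {0}) (\<lambda>z. (1 - (1 - z) powr complex_of_real s) / z)"
    by (intro continuous_on_divide continuous_on_diff continuous_on_const continuous_on_id) auto
  then show ?thesis
    by (rule continuous_on_eq) (auto simp: powr_quotient_def)
qed

definition hardy_fun :: "real \<Rightarrow> real \<Rightarrow> complex \<Rightarrow> complex" where
  "hardy_fun s a z = powr_quotient s z powr of_real a"

lemma hardy_fun_of_real:
  assumes "x \<le> 1" "0 < s"
  shows "hardy_fun s a (of_real x) = of_real ((if x = 0 then s else (1 - (1 - x) powr s) / x) powr a)"
  unfolding hardy_fun_def powr_quotient_of_real[OF assms(1)]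
  using powr_quotient_real_pos[of s x] assms by (subst powr_of_real) auto

lemma hardy_fun_cnj:
  assumes "0 < s" "s < 1" "norm z < 1"
  shows "hardy_fun s a (cnj z) = cnj (hardy_fun s a z)"
proof -
  have "Re z \<le> 1" using assms complex_Re_le_cmod[of z] by linarith
  then show ?thesis
    using powr_quotient_notin_nonpos_ball[OF assms]
    by (auto simp: hardy_fun_def powr_quotient_cnj cnj_powr complex_nonpos_Reals_iff)
qed

lemma hardy_fun_holomorphic_ball:
  assumes "0 < s" "s < 1"
  shows "hardy_fun s a holomorphic_on ball 0 1"
  unfolding hardy_fun_def
proof (intro holomorphic_intros powr_quotient_holomorphic)
  show "1 - z \<notin> \<real>\<^sub>\<le>\<^sub>0" if "z \<in> ball 0 1" for z :: complex
    using that complex_Re_le_cmod[of z] by (auto simp: complex_nonpos_Reals_iff)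
qed (use assms powr_quotient_notin_nonpos_ball in auto)

lemma hardy_fun_holomorphic_lower:
  assumes "0 < s" "s < 1"
  shows "hardy_fun s a holomorphic_on {z. Im z < 0}"
  unfolding hardy_fun_def
  by (intro holomorphic_intros powr_quotient_holomorphic open_halfspace_Im_lt)
    (use assms powr_quotient_notin_nonpos_lower in \<open>auto simp: complex_nonpos_Reals_iff\<close>)

lemma hardy_fun_continuous_lower:
  assumes "0 < s" "s < 1"
  shows "continuous_on ({z. Im z \<le> 0} - {0}) (hardy_fun s a)"
proof -
  have "powr_quotient s z \<notin> \<real>\<^sub>\<le>\<^sub>0" if "Im z \<le> 0" for z
    using that assms by (intro powr_quotient_notin_nonpos_lower)
  then have "\<forall>z. Im z \<le> 0 \<longrightarrow> powr_quotient s z \<noteq> 0 \<and>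
      (0 \<le> Re (powr_quotient s z) \<or> Im (powr_quotient s z) \<noteq> 0)"
    by (metis complex_nonpos_Reals_iff linorder_le_cases zero_complex.sel)
  then show ?thesis
    unfolding hardy_fun_def using assms
    by (intro continuous_on_powr_complex powr_quotient_continuous_lower continuous_intros) auto
qed

subsection \<open>The contour integral over the strip\<close>

text \<open>With z = exp w this is Cauchy's integrand H z / z ^ (n + 1) dz in the coordinate w; the
  exponent drops to n because dz = z dw.\<close>

definition strip_fun :: "real \<Rightarrow> real \<Rightarrow> nat \<Rightarrow> complex \<Rightarrow> complex" where
  "strip_fun s a n w = hardy_fun s a (exp w) * exp (- (of_nat n * w))"

lemma strip_fun_continuous:
  assumes "0 < s" "s < 1"
  shows "continuous_on {w. - pi \<le> Im w \<and> Im w \<le> 0} (strip_fun s a n)"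
  unfolding strip_fun_def
proof (intro continuous_intros continuous_on_compose2[OF hardy_fun_continuous_lower[OF assms]])
  show "exp ` {w. - pi \<le> Im w \<and> Im w \<le> 0} \<subseteq> {z. Im z \<le> 0} - {0}"
    using sin_ge_zero[of "- Im w" for w] by (auto simp: Im_exp mult_nonneg_nonpos)
qed

lemma strip_fun_holomorphic:
  assumes "0 < s" "s < 1"
  shows "strip_fun s a n holomorphic_on {w. - pi < Im w \<and> Im w < 0}"
  unfolding strip_fun_def
proof (intro holomorphic_intros
    holomorphic_on_compose_gen[OF _ hardy_fun_holomorphic_lower[OF assms], unfolded comp_def])
  show "exp ` {w. - pi < Im w \<and> Im w < 0} \<subseteq> {z. Im z < 0}"
    using sin_gt_zero[of "- Im w" for w] by (auto simp: Im_exp mult_pos_neg)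
qed

text \<open>Cauchy's formula on the circle of radius exp x < 1. Since H commutes with conjugation,
  the upper half circle contributes the conjugate of the lower one, so twice the real part of the
  lower half remains and the coefficient is real.\<close>

lemma taylor_coeff_integral:
  assumes s: "0 < s" "s < 1" and "x < 0"
  shows "(deriv ^^ n) (hardy_fun s a) 0 / fact n =
    of_real (Re (integral {-pi..0} (\<lambda>y. strip_fun s a n (Complex x y))) / pi)"
proof -
  define r where "r = exp x"
  define G where "G y = strip_fun s a n (Complex x y)" for y
  have r: "0 < r" "r < 1" using \<open>x < 0\<close> by (auto simp: r_def)
  have exp_eq: "exp (Complex x y) = of_real r * cis y" for y
    by (simp add: r_def exp_eq_polar)
  have G_eq: "G y = hardy_fun s a (of_real r * cis y) / (of_real r * cis y) ^ n" for y
    by (simp add: G_def strip_fun_def exp_minus exp_of_nat_mult exp_eq field_simps)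
  have per: "G (2 * pi + y) = G y" for y
    by (simp add: G_eq flip: cis_mult)
  have cnj: "G (- y) = cnj (G y)" for y
    using hardy_fun_cnj[of s "of_real r * cis y" a] s r
    by (simp add: G_eq norm_mult cis_cnj)
  have cont: "continuous_on S G" for S
  proof -
    have "continuous_on UNIV (\<lambda>y. hardy_fun s a (of_real r * cis y))"
      using r by (intro continuous_on_compose2[OF
          holomorphic_on_imp_continuous_on[OF hardy_fun_holomorphic_ball[OF s]]] continuous_intros)
        (auto simp: norm_mult)
    then show ?thesis
      unfolding G_eq using r by (intro continuous_intros) (auto elim: continuous_on_subset)
  qed
  have int: "G integrable_on {u..v}" for u v
    using cont by (rule integrable_continuous_interval)
  have "2 * of_real pi * \<i> * ((deriv ^^ n) (hardy_fun s a) 0 / fact n)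
      = contour_integral (circlepath 0 r) (\<lambda>u. hardy_fun s a u / (u - 0) ^ Suc n)"
  proof (subst Cauchy_contour_integral_circlepath)
    have "cball 0 r \<subseteq> ball (0::complex) 1" using r by auto
    then show "continuous_on (cball 0 r) (hardy_fun s a)" "hardy_fun s a holomorphic_on ball 0 r"
      using holomorphic_on_subset[OF hardy_fun_holomorphic_ball[OF s, of a]] ball_subset_cball
      by (blast intro: holomorphic_on_imp_continuous_on)+
  qed (use r in auto)
  also have "\<dots> = integral {0..2 * pi} (\<lambda>y. \<i> * G y)"
    unfolding circlepath_def using r
    by (subst contour_integral_part_circlepath_eq) (auto simp: G_eq intro!: integral_cong)
  also have "\<dots> = \<i> * integral {0..2 * pi} G" by simp
  finally have "2 * of_real pi * ((deriv ^^ n) (hardy_fun s a) 0 / fact n) = integral {0..2 * pi} G"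
    by (simp add: mult.commute[of _ \<i>] mult.assoc flip: times_divide_eq_right)
  also have "\<dots> = integral {0..pi} G + integral {pi..2 * pi} G"
    by (intro Henstock_Kurzweil_Integration.integral_combine[symmetric] int) auto
  also have "integral {pi..2 * pi} G = integral {-pi..0} G"
    using integral_shift_Icc_real[of "-pi" 0 G "2 * pi"] per by (simp add: comp_def)
  also have "integral {0..pi} G = cnj (integral {-pi..0} G)"
    unfolding integral_cnj cnj[symmetric]
    by (metis Henstock_Kurzweil_Integration.integral_reflect_real minus_zero)
  finally have "2 * of_real pi * ((deriv ^^ n) (hardy_fun s a) 0 / fact n)
      = of_real (2 * Re (integral {-pi..0} G))"
    by (simp only: complex_add_cnj add.commute)
  then show ?thesis
    unfolding G_def[abs_def] by (simp add: field_simps)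
qed

lemma norm_powr_quotient_le:
  assumes "0 < s" "z \<noteq> 0"
  shows "norm (powr_quotient s z) \<le> (1 + (1 + norm z) powr s) / norm z"
proof -
  have "norm (1 - z) powr s \<le> (1 + norm z) powr s"
    using assms norm_triangle_ineq4[of 1 z] by (intro powr_mono2) auto
  then have "norm (1 - (1 - z) powr of_real s) \<le> 1 + (1 + norm z) powr s"
    by (intro order_trans[OF norm_triangle_ineq4]) (simp add: norm_powr_real_powr')
  then show ?thesis
    using assms by (simp add: powr_quotient_def norm_divide divide_right_mono)
qed

lemma norm_hardy_fun_le:
  assumes "0 < s" "0 < a" "z \<noteq> 0"
  shows "norm (hardy_fun s a z) \<le> ((1 + (1 + norm z) powr s) / norm z) powr a"
  using assms by (auto simp: hardy_fun_def norm_powr_real_powr' intro!: powr_mono2 norm_powr_quotient_le)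

text \<open>The base decays like r powr (s - 1) with s < 1, and the exponent a is positive.\<close>

lemma hardy_bound_tendsto_0:
  fixes s a :: real
  assumes "0 < s" "s < 1" "0 < a"
  shows "((\<lambda>r. ((1 + (1 + r) powr s) / r) powr a) \<longlongrightarrow> 0) at_top"
proof -
  have "((\<lambda>r. (1 + (1 + r) powr s) / r) \<longlongrightarrow> 0) at_top"
    using assms(1,2) by real_asymp
  moreover have "\<forall>\<^sub>F r in at_top. 0 \<le> (1 + (1 + r) powr s) / r"
    by (intro eventually_at_top_linorderI[of 0]) auto
  ultimately show ?thesis
    using tendsto_zero_powrI[OF _ tendsto_const] \<open>0 < a\<close> by blast
qed

text \<open>The decay comes from H alone, uniformly in y; the factor exp (- n x) is merely bounded
  by 1 for x >= 0.\<close>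

lemma strip_integral_tendsto_0:
  assumes "0 < s" "s < 1" "0 < a"
  shows "((\<lambda>x. integral {-pi..0} (\<lambda>y. strip_fun s a n (Complex x y))) \<longlongrightarrow> 0) at_top"
proof (rule Lim_null_comparison)
  have "norm (integral {-pi..0} (\<lambda>y. strip_fun s a n (Complex x y)))
      \<le> ((1 + (1 + exp x) powr s) / exp x) powr a * (0 - (-pi))" if "0 \<le> x" for x
  proof (rule integral_bound)
    show "continuous_on {-pi..0} (\<lambda>y. strip_fun s a n (Complex x y))"
      by (rule continuous_on_compose2[OF strip_fun_continuous[OF assms(1,2)]])
        (auto simp: Complex_eq intro!: continuous_intros)
    fix y
    have "norm (strip_fun s a n (Complex x y))
        = norm (hardy_fun s a (exp (Complex x y))) * exp (- (real n * x))"
      by (simp add: strip_fun_def norm_mult)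
    also have "\<dots> \<le> ((1 + (1 + exp x) powr s) / exp x) powr a * 1"
      using assms that norm_hardy_fun_le[of s a "exp (Complex x y)"] by (intro mult_mono) auto
    finally show "norm (strip_fun s a n (Complex x y)) \<le> ((1 + (1 + exp x) powr s) / exp x) powr a"
      by simp
  qed auto
  then show "\<forall>\<^sub>F x in at_top. norm (integral {-pi..0} (\<lambda>y. strip_fun s a n (Complex x y)))
      \<le> ((1 + (1 + exp x) powr s) / exp x) powr a * pi"
    by (intro eventually_at_top_linorderI[of 0]) auto
  show "((\<lambda>x. ((1 + (1 + exp x) powr s) / exp x) powr a * pi) \<longlongrightarrow> 0) at_top"
    using filterlim_compose[OF hardy_bound_tendsto_0[OF assms] exp_at_top]
    by (intro tendsto_mult_left_zero)
qed

text \<open>Imaginary parts in Cauchy's theorem on the rectangle [-1, x] x [-pi, 0]. The left edge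
  yields the coefficient. On the bottom edge z is negative and the integrand real; on the top edge z
  is positive and the integrand is real until z reaches the cut at t = 0.\<close>

lemma taylor_coeff_strip:
  assumes s: "0 < s" "s < 1" and "0 \<le> x"
  shows "pi * Re ((deriv ^^ n) (hardy_fun s a) 0 / fact n) =
    Re (integral {-pi..0} (\<lambda>y. strip_fun s a n (Complex x y)))
      - integral {0..x} (\<lambda>t. Im (hardy_fun s a (of_real (exp t))) * exp (- (real n * t)))"
proof -
  have cont: "continuous_on {-1..x} (\<lambda>t. strip_fun s a n (Complex t y))" if "y \<in> {-pi..0}" for y
    using that by (intro continuous_on_compose2[OF strip_fun_continuous[OF s]])
        (auto simp: Complex_eq intro!: continuous_intros)
  have exp_bot: "exp (Complex t (-pi)) = of_real (- exp t)" for t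
    by (simp add: exp_eq_polar cis_def complex_eq_iff)
  have exp_top: "exp (Complex t 0) = of_real (exp t)" for t
    by (simp add: exp_eq_polar)
  \<comment> \<open>At y = - pi the factor is exp (- n t) up to the sign (-1) ^ n.\<close>
  have real_exp: "Im (exp (- (of_nat n * Complex t y))) = 0" if "y = 0 \<or> y = - pi" for t y
    using that sin_npi[of n] by (auto simp: Im_exp)
  have Im_int: "Im (integral {-1..x} (\<lambda>t. strip_fun s a n (Complex t y))) =
      integral {-1..x} (\<lambda>t. Im (strip_fun s a n (Complex t y)))" if "y \<in> {-pi..0}" for y
    using integral_linear[OF integrable_continuous_interval[OF cont[OF that]] bounded_linear_Im]
    by (simp add: comp_def)
  have "Im (strip_fun s a n (Complex t (-pi))) = 0" for t
    using real_exp[of "-pi" t] hardy_fun_of_real[of "- exp t" s a] s exp_gt_zero[of t]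
    by (simp add: strip_fun_def exp_bot)
  then have bot: "Im (integral {-1..x} (\<lambda>t. strip_fun s a n (Complex t (-pi)))) = 0"
    by (simp add: Im_int)
  define g where "g t = Im (strip_fun s a n (Complex t 0))" for t
  have g_eq: "g t = Im (hardy_fun s a (of_real (exp t))) * exp (- (real n * t))" for t
    using real_exp[of 0] by (auto simp: g_def strip_fun_def exp_top Re_exp)
  have "g t = 0" if "t \<le> 0" for t
    using that s hardy_fun_of_real[of "exp t" s a] 
    unfolding g_eq by (simp del: of_real_exp)
  then have "integral {-1..0} g = 0"
    by (intro integral_unique has_integral_is_0) auto
  moreover have "continuous_on {-1..x} g"
    unfolding g_def using cont[of 0] by (intro continuous_intros) auto
  then have "integral {-1..0} g + integral {0..x} g = integral {-1..x} g"
    using \<open>0 \<le> x\<close> by (intro Henstock_Kurzweil_Integration.integral_combine integrable_continuous_interval) auto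
  ultimately have top: "Im (integral {-1..x} (\<lambda>t. strip_fun s a n (Complex t 0))) = integral {0..x} g"
    by (simp add: Im_int g_def[abs_def])
  have "integral {-1..x} (\<lambda>t. strip_fun s a n (Complex t (-pi)))
        + \<i> * integral {-pi..0} (\<lambda>y. strip_fun s a n (Complex x y))
      = integral {-1..x} (\<lambda>t. strip_fun s a n (Complex t 0))
        + \<i> * integral {-pi..0} (\<lambda>y. strip_fun s a n (Complex (-1) y))"
    by (rule Cauchy_rectangle)
      (use \<open>0 \<le> x\<close> in \<open>auto intro!: continuous_on_subset[OF strip_fun_continuous[OF s]]
        holomorphic_on_subset[OF strip_fun_holomorphic[OF s]]
        simp: in_cbox_complex_iff in_box_complex_iff\<close>)
  from arg_cong[OF this, of Im] bot top taylor_coeff_integral[OF s, of "-1" n a]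
  show ?thesis
    by (simp add: g_eq[abs_def])
qed

subsection \<open>The density and its moments\<close>

lemma continuous_on_Icc_at_rightI:
  fixes f :: "real \<Rightarrow> 'a::topological_space"
  assumes "continuous_on {a<..b} f" "(f \<longlongrightarrow> f a) (at_right a)" "a < b"
  shows "continuous_on {a..b} f"
  unfolding continuous_on_def
proof
  fix x assume x: "x \<in> {a..b}"
  show "(f \<longlongrightarrow> f x) (at x within {a..b})"
  proof (cases "x = a")
    case True
    with assms show ?thesis by (simp add: at_within_Icc_at_right)
  next
    case False
    with x have "at x within {a..b} = at x within {a<..b}"
      by (intro at_within_nhd[where S = "{a<..}"]) auto
    with x False assms(1) show ?thesis by (simp add: continuous_on_def)
  qed
qed

text \<open>As 1 - 1 / t <= 0, its principal power is e^(i pi / q) * (1 / t - 1) powr (1 / q), the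
  value approached from the lower half-plane. The positive factor t can be pulled out of the outer
  power.\<close>

lemma rho_eq:
  assumes "q > 0" "t \<in> {0<..1}"
  shows "rho p q t = - Im (hardy_fun (1 / q) (p - 1) (of_real (1 / t))) / pi"
proof -
  let ?e = "exp (\<i> * of_real pi / of_real q)" and ?r = "(1 / t - 1) powr (1 / q)"
  have "of_real (1 - 1 / t) powr complex_of_real (1 / q) = ?e * of_real ?r"
    using assms by (subst powr_of_real_if) (auto simp: field_simps)
  then have "powr_quotient (1 / q) (of_real (1 / t)) = of_real t * (1 - ?e * of_real ?r)"
    using assms by (simp add: powr_quotient_def)
  then have "hardy_fun (1 / q) (p - 1) (of_real (1 / t))
      = of_real (t powr (p - 1)) * (1 - ?e * of_real ?r) powr of_real (p - 1)"
    using assms unfolding hardy_fun_def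
    by (simp only:) (subst powr_times_real_left; simp add: powr_of_real del: of_real_diff)
  then show ?thesis
    using assms by (simp add: rho_def limit_at_zero_def)
qed

lemma rho_at_0:
  assumes "p > 1" "q > 1"
  shows "rho p q 0 = 0" "(rho p q \<longlongrightarrow> 0) (at_right 0)"
proof -
  let ?g = "\<lambda>r. ((1 + (1 + r) powr (1 / q)) / r) powr (p - 1)"
  have "norm (rho p q t) \<le> ?g (inverse t) * (1 / pi)" if "t \<in> {0<..<1}" for t
  proof -
    have "norm (rho p q t) \<le> norm (hardy_fun (1 / q) (p - 1) (of_real (1 / t))) / pi"
      using assms that by (auto simp: rho_eq divide_right_mono abs_Im_le_cmod)
    also have "\<dots> \<le> ?g (inverse t) / pi"
      using norm_hardy_fun_le[of "1 / q" "p - 1" "of_real (1 / t)"] assms that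
      by (intro divide_right_mono) (auto simp: norm_divide inverse_eq_divide)
    finally show ?thesis by simp
  qed
  then have "\<forall>\<^sub>F t in at_right 0. norm (rho p q t) \<le> ?g (inverse t) * (1 / pi)"
    by (intro eventually_at_rightI[of 0 1]) auto
  moreover have "((\<lambda>t. ?g (inverse t) * (1 / pi)) \<longlongrightarrow> 0) (at_right 0)"
    using filterlim_compose[OF hardy_bound_tendsto_0[of "1 / q" "p - 1"] filterlim_inverse_at_top_right] assms
    by (intro tendsto_mult_left_zero) auto
  ultimately show lim: "(rho p q \<longlongrightarrow> 0) (at_right 0)"
    by (rule Lim_null_comparison)
  \<comment> \<open>By definition the value at 0 is \<open>Lim\<close> of the bare formula, so the
    limit of \<open>rho\<close> has to be transferred to that formula.\<close>
  have "\<forall>\<^sub>F t in at_right 0. rho p q t = - (1 / pi) * t powr (p - 1) *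
      Im ((1 - exp (\<i> * of_real pi / of_real q) * of_real ((1 / t - 1) powr (1 / q)))
            powr of_real (p - 1))"
    by (intro eventually_at_rightI[of 0 1]) (auto simp: rho_def limit_at_zero_def)
  from tendsto_Lim[OF _ Lim_transform_eventually[OF lim this]]
  show "rho p q 0 = 0"
    by (simp add: rho_def limit_at_zero_def)
qed

lemma rho_continuous:
  assumes "p > 1" "q > 1"
  shows "continuous_on {0..1} (rho p q)"
proof (rule continuous_on_Icc_at_rightI)
  have "continuous_on {0<..1} (\<lambda>t. - Im (hardy_fun (1 / q) (p - 1) (of_real (1 / t))) / pi)"
    using assms
    by (intro continuous_intros continuous_on_compose2[OF hardy_fun_continuous_lower]) auto
  then show "continuous_on {0<..1} (rho p q)"
    by (rule continuous_on_eq) (use assms in \<open>simp add: rho_eq\<close>)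
qed (use rho_at_0[OF assms] in auto)

text \<open>With \<open>s = 1 / q\<close>, the base \<open>1 - r * exp (\<i> * pi * s)\<close> has argument in $(-\pi(1-s), 0)$; raising it to the power
  \<open>p - 1 = s / (1 - s)\<close> brings the argument into $(-\pi s, 0)$, where the sine is negative.\<close>

lemma rho_pos:
  assumes "p > 1" "q > 1" "1 / p + 1 / q = 1" "t \<in> {0<..<1}"
  shows "rho p q t > 0"
proof -
  define s where "s = 1 / q"
  define r where "r = (1 / t - 1) powr s"
  define B where "B = 1 - exp (\<i> * of_real pi / of_real q) * of_real r"
  have s: "0 < s" "s < 1" using assms by (auto simp: s_def)
  have "r > 0" using assms by (simp add: r_def)
  have exp_s: "exp (\<i> * of_real pi / of_real q) = cis (pi * s)"
    by (simp add: s_def cis_conv_exp)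
  have "pi * s < pi" using s by simp
  then have "sin (pi * s) > 0" using s by (intro sin_gt_zero) auto
  then have ImB: "Im B < 0" using \<open>r > 0\<close> by (simp add: B_def exp_s)
  then have "B \<noteq> 0" by auto
  define \<theta> where "\<theta> = Im (Ln B)"
  have B_eq: "B = of_real (norm B) * cis \<theta>"
    using \<open>B \<noteq> 0\<close> exp_Ln[of B] by (simp add: \<theta>_def exp_eq_polar)
  have \<theta>: "- pi < \<theta>" "\<theta> < 0"
    using ImB mpi_less_Im_Ln[OF \<open>B \<noteq> 0\<close>] Im_Ln_pos_le[OF \<open>B \<noteq> 0\<close>] Im_Ln_le_pi[OF \<open>B \<noteq> 0\<close>]
    by (auto simp: \<theta>_def not_le[symmetric])
  \<comment> \<open>Lower bound for the argument: this rotation makes the subtracted term real,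
    leaving the imaginary part sin (pi * (1 - s)) = sin (pi * s) > 0. The rotated angle exceeds -
    pi, so it cannot be nonpositive.\<close>
  have "B * cis (pi * (1 - s)) = cis (pi * (1 - s)) - of_real r * cis pi"
    by (simp add: B_def exp_s algebra_simps cis_mult)
  then have "Im (B * cis (pi * (1 - s))) = sin (pi * s)"
    by (simp add: right_diff_distrib)
  moreover have "Im (B * cis (pi * (1 - s))) = norm B * sin (\<theta> + pi * (1 - s))"
    by (subst B_eq) (simp add: cis_mult mult.assoc)
  ultimately have "sin (\<theta> + pi * (1 - s)) > 0"
    using \<open>sin (pi * s) > 0\<close> \<open>B \<noteq> 0\<close> by (metis zero_less_mult_pos zero_less_norm_iff)
  moreover have "sin (\<theta> + pi * (1 - s)) \<le> 0" if "\<theta> + pi * (1 - s) \<le> 0"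
  proof -
    have "- (\<theta> + pi * (1 - s)) \<le> pi"
      using \<theta> \<open>pi * s < pi\<close> unfolding right_diff_distrib by linarith
    then have "sin (- (\<theta> + pi * (1 - s))) \<ge> 0"
      using that by (intro sin_ge_zero) auto
    then show ?thesis by (simp only: sin_minus)
  qed
  ultimately have \<theta>_gt: "- (pi * (1 - s)) < \<theta>" by linarith
  have "(p - 1) * (1 - s) = s"
    using assms by (simp add: s_def field_simps)
  then have "(p - 1) * - (pi * (1 - s)) = - (pi * s)"
    by (metis mult.left_commute mult_minus_right)
  moreover have "(p - 1) * - (pi * (1 - s)) < (p - 1) * \<theta>"
    using assms(1) by (intro mult_strict_left_mono[OF \<theta>_gt]) simp
  ultimately have "(p - 1) * \<theta> > - (pi * s)" by linarith
  then have "- ((p - 1) * \<theta>) < pi"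
    using \<open>pi * s < pi\<close> by linarith
  then have "sin (- ((p - 1) * \<theta>)) > 0"
    using \<theta> assms(1) by (intro sin_gt_zero) (auto simp: mult_pos_neg)
  moreover have "Im (B powr of_real (p - 1)) = norm B powr (p - 1) * sin ((p - 1) * \<theta>)"
    using \<open>B \<noteq> 0\<close> by (simp add: powr_def Im_exp \<theta>_def del: of_real_diff)
  ultimately have "Im (B powr of_real (p - 1)) < 0"
    using \<open>B \<noteq> 0\<close> by (simp add: mult_pos_neg)
  then have "t powr (p - 1) * Im (B powr of_real (p - 1)) < 0"
    using assms by (intro mult_pos_neg) auto
  then show ?thesis
    using assms by (simp add: rho_def limit_at_zero_def B_def r_def s_def field_simps)
qed

text \<open>Substituting exp (- t) in the top-edge integral of \<open>taylor_coeff_strip\<close>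
  uses up one exponential factor as Jacobian, so coefficient n + 1 goes with the n-th power. As x
  grows, the right edge vanishes and the lower limit exp (- x) tends to 0.\<close>

lemma taylor_coeff_rho:
  assumes "p > 1" "q > 1"
  shows "Re ((deriv ^^ Suc n) (hardy_fun (1 / q) (p - 1)) 0 / fact (Suc n))
    = integral {0..1} (\<lambda>t. t ^ n * rho p q t)"
proof -
  define f where "f t = t ^ n * rho p q t" for t
  define K where "K x = integral {-pi..0} (\<lambda>y. strip_fun (1 / q) (p - 1) (Suc n) (Complex x y))" for x
  let ?c = "Re ((deriv ^^ Suc n) (hardy_fun (1 / q) (p - 1)) 0 / fact (Suc n))"
  have s: "0 < 1 / q" "1 / q < 1" "0 < p - 1" using assms by auto
  have contf: "continuous_on {0..1} f"
    unfolding f_def by (intro continuous_intros rho_continuous assms)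
  have "?c = Re (K x) / pi + integral {exp (- x)..1} f" if "0 \<le> x" for x
  proof -
    have "((\<lambda>t. - exp (- t) *\<^sub>R f (exp (- t))) has_integral
        (integral {exp (- 0)..exp (- x)} f - integral {exp (- x)..exp (- 0)} f)) {0..x}"
      using that contf
      by (intro has_integral_substitution_general[of "{}" 0 x _ 0 1])
        (auto intro!: derivative_eq_intros continuous_intros)
    \<comment> \<open>The substitution is decreasing, so this interval is empty or a single
      point.\<close>
    moreover have "integral {exp (- 0)..exp (- x)} f = 0"
      using that by (cases "x = 0") auto
    ultimately have "((\<lambda>t. - (exp (- t) * f (exp (- t)))) has_integral - integral {exp (- x)..1} f) {0..x}"
      by simp
    from has_integral_mult_right[OF this, of pi]
    have "((\<lambda>t. pi * - (exp (- t) * f (exp (- t)))) has_integral pi * - integral {exp (- x)..1} f) {0..x}" .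
    moreover have "pi * - (exp (- t) * f (exp (- t))) =
        Im (hardy_fun (1 / q) (p - 1) (of_real (exp t))) * exp (- (real (Suc n) * t))"
      if "t \<in> {0..x}" for t
    proof -
      have "exp (- (real (Suc n) * t)) = exp (- t) * exp (- t) ^ n"
        by (simp add: algebra_simps flip: exp_of_nat_mult exp_add)
      then show ?thesis
        using that assms rho_eq[of q "exp (- t)" p]
        by (simp add: f_def exp_minus field_simps del: of_real_exp)
    qed
    ultimately have "((\<lambda>t. Im (hardy_fun (1 / q) (p - 1) (of_real (exp t))) * exp (- (real (Suc n) * t)))
        has_integral pi * - integral {exp (- x)..1} f) {0..x}"
      by (subst has_integral_cong[symmetric]) auto
    then have "integral {0..x} (\<lambda>t. Im (hardy_fun (1 / q) (p - 1) (of_real (exp t))) * exp (- (real (Suc n) * t)))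
        = pi * - integral {exp (- x)..1} f"
      by (rule integral_unique)
    with taylor_coeff_strip[OF s(1,2) that, of "Suc n" "p - 1"]
    have "pi * ?c = Re (K x) + pi * integral {exp (- x)..1} f"
      by (simp add: K_def)
    then show ?thesis by (simp add: field_simps)
  qed
  then have "\<forall>\<^sub>F x in at_top. ?c = Re (K x) / pi + integral {exp (- x)..1} f"
    by (intro eventually_at_top_linorderI[of 0])
  moreover have "((\<lambda>x. Re (K x) / pi + integral {exp (- x)..1} f) \<longlongrightarrow> Re 0 / pi + integral {0..1} f) at_top"
  proof (intro tendsto_intros)
    show "(K \<longlongrightarrow> 0) at_top"
      unfolding K_def by (rule strip_integral_tendsto_0[OF s])
    show "((\<lambda>x. integral {exp (- x)..1} f) \<longlongrightarrow> integral {0..1} f) at_top"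
    proof (rule continuous_on_tendsto_compose[where s = "{0..1}" and f = "\<lambda>u. integral {u..1} f"])
      show "continuous_on {0..1} (\<lambda>u. integral {u..1} f)"
        by (intro indefinite_integral_continuous_1' integrable_continuous_interval contf)
      show "((\<lambda>x::real. exp (- x)) \<longlongrightarrow> 0) at_top"
        by (intro filterlim_compose[OF exp_at_bot] filterlim_uminus_at_bot_at_top)
      show "\<forall>\<^sub>F x::real in at_top. exp (- x) \<in> {0..1}"
        by (intro eventually_at_top_linorderI[of 0]) auto
    qed auto
  qed auto
  ultimately have "((\<lambda>_. ?c) \<longlongrightarrow> Re 0 / pi + integral {0..1} f) (at_top :: real filter)"
    by (simp cong: tendsto_cong)
  then show ?thesis
    by (simp add: tendsto_const_iff f_def[abs_def])
qed

lemma moment_even: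
  assumes "p > 1" "q > 1"
  shows "moment p q (2 * k) = 2 * integral {0..1} (\<lambda>t. t ^ (2 * k) * rho p q t)"
proof -
  define f where "f t = t ^ (2 * k) * rho p q \<bar>t\<bar>" for t
  have cont: "continuous_on {-1..1} f"
    unfolding f_def by (intro continuous_intros continuous_on_compose2[OF rho_continuous[OF assms]]) auto
  have "moment p q (2 * k) = integral {-1..1} f"
    unfolding moment_def f_def[symmetric]
    by (rule set_borel_integral_eq_integral(2)[OF borel_integrable_atLeastAtMost'[OF cont]])
  also have "\<dots> = integral {-1..0} f + integral {0..1} f"
    using cont
    by (intro Henstock_Kurzweil_Integration.integral_combine[symmetric] integrable_continuous_interval) auto
  also have "integral {-1..0} f = integral {0..1} f"
    using Henstock_Kurzweil_Integration.integral_reflect_real[of 1 0 f] by (simp add: f_def[abs_def])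
  also have "integral {0..1} f = integral {0..1} (\<lambda>t. t ^ (2 * k) * rho p q t)"
    by (intro integral_cong) (simp add: f_def)
  finally show ?thesis by simp
qed

text \<open>A continuous nonnegative integrand with integral 0 would vanish identically, but it is
  positive at 1/2.\<close>

lemma moment_even_pos:
  assumes "p > 1" "q > 1" "1 / p + 1 / q = 1"
  shows "moment p q (2 * k) > 0"
proof -
  define f where "f t = t ^ (2 * k) * rho p q t" for t
  have cont: "continuous_on {0..1} f"
    unfolding f_def by (intro continuous_intros rho_continuous assms)
  then have int: "f integrable_on {0..1}"
    by (rule integrable_continuous_interval)
  \<comment> \<open>\<open>rho_pos\<close> leaves out the endpoints; at the branch point z = 1 the
    value of H is still real.\<close>
  have "rho p q 1 = 0"
    using rho_eq[of q 1 p] hardy_fun_of_real[of 1 "1 / q" "p - 1"] assms by simp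
  then have nonneg: "f t \<ge> 0" if "t \<in> {0..1}" for t
    using rho_pos[OF assms, of t] rho_at_0(1)[OF assms(1,2)] that
    by (cases "t = 0 \<or> t = 1") (auto simp: f_def)
  have "f (1/2) > 0"
    using rho_pos[OF assms, of "1/2"] by (simp add: f_def)
  have "integral {0..1} f \<noteq> 0"
  proof
    assume "integral {0..1} f = 0"
    then have "(f has_integral 0) (cbox 0 1)"
      using integrable_integral[OF int] by simp
    then have "f (1/2) = 0"
      by (rule has_integral_0_cbox_imp_0[rotated 2]) (use cont nonneg in auto)
    with \<open>f (1/2) > 0\<close> show False by simp
  qed
  moreover have "integral {0..1} f \<ge> 0"
    using nonneg by (intro integral_nonneg int)
  ultimately show ?thesis
    unfolding moment_even[OF assms(1,2)] by (simp add: f_def[abs_def])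
qed

subsection \<open>Power series with nonnegative coefficients\<close>

lemma powser_deriv_open_unit:
  fixes g :: "real \<Rightarrow> real"
  assumes sums: "\<And>x. x \<in> {0<..<1} \<Longrightarrow> (\<lambda>n. b n * x ^ n) sums g x" and x: "x \<in> {0<..<1}"
  shows "(g has_field_derivative (\<Sum>n. diffs b n * x ^ n)) (at x)"
    and "summable (\<lambda>n. diffs b n * x ^ n)"
proof -
  have summable: "summable (\<lambda>n. b n * y ^ n)" if y: "norm y < 1" for y
  proof -
    \<comment> \<open>Convergence is given on the positive side only; a point z closer to 1 yields
      it on the whole disc of radius z.\<close>
    obtain z where "norm y < z" "z < 1" using dense[OF y] by blast
    moreover from this have "0 < z" using norm_ge_zero[of y] by linarith
    ultimately have "summable (\<lambda>n. b n * z ^ n)" "norm y < norm z"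
      using sums[of z] by (auto simp: sums_iff)
    then show ?thesis by (rule powser_inside)
  qed
  have "((\<lambda>x. \<Sum>n. b n * x ^ n) has_field_derivative (\<Sum>n. diffs b n * x ^ n)) (at x)"
    using x by (intro termdiffs_strong'[where K = 1] summable) auto
  then show "(g has_field_derivative (\<Sum>n. diffs b n * x ^ n)) (at x)"
    by (rule has_field_derivative_transform_within_open[where S = "{0<..<1}"])
      (use x sums in \<open>auto simp: sums_iff\<close>)
  show "summable (\<lambda>n. diffs b n * x ^ n)"
    using x by (intro termdiff_converges[where K = 1] summable) auto
qed

text \<open>Each differentiation replaces b n by (n + 1) * b (n + 1), which preserves
  nonnegativity.\<close>

lemma powser_derivs_nonneg:
  fixes g :: "real \<Rightarrow> real"
  assumes "\<And>x. x \<in> {0<..<1} \<Longrightarrow> (\<lambda>n. b n * x ^ n) sums g x" and "\<And>n. 0 \<le> b n"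
    and x: "x \<in> {0<..<1}"
  shows "(deriv ^^ n) g field_differentiable at x" and "(deriv ^^ n) g x \<ge> 0"
proof -
  have nonneg: "0 \<le> (diffs ^^ n) b k" for k
    by (induction n arbitrary: k) (auto simp: diffs_def assms(2))
  have sums: "(\<lambda>k. (diffs ^^ n) b k * y ^ k) sums (deriv ^^ n) g y" if "y \<in> {0<..<1}" for y
    using that
  proof (induction n arbitrary: y)
    case (Suc n)
    from powser_deriv_open_unit[OF Suc.IH Suc.prems] show ?case
      by (simp add: DERIV_imp_deriv summable_sums)
  qed (simp add: assms(1))
  show "(deriv ^^ n) g field_differentiable at x"
    using powser_deriv_open_unit(1)[OF sums x] field_differentiable_def by blast
  show "(deriv ^^ n) g x \<ge> 0"
    by (rule sums_le[OF _ sums_zero sums[OF x]]) (use x nonneg in auto)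
qed

text \<open>A converse of Abel's theorem that nonnegativity makes possible: partial sums at x < 1
  are below g x, so in the limit they are bounded by L; conversely g x is below the sum of
  b.\<close>

lemma powser_sums_at_1:
  fixes g :: "real \<Rightarrow> real"
  assumes sums: "\<And>x. x \<in> {0<..<1} \<Longrightarrow> (\<lambda>n. b n * x ^ n) sums g x" and nonneg: "\<And>n. 0 \<le> b n"
    and lim: "(g \<longlongrightarrow> L) (at_left 1)"
  shows "b sums L"
proof -
  have ev: "\<forall>\<^sub>F x in at_left 1. x \<in> {0<..<(1::real)}"
    using eventually_at_left_real[of 0 1] by simp
  have partial: "sum b {..<N} \<le> L" for N
  proof (rule tendsto_le)
    show "((\<lambda>x. \<Sum>n<N. b n * x ^ n) \<longlongrightarrow> sum b {..<N}) (at_left 1)"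
      by (auto intro!: tendsto_eq_intros)
    show "\<forall>\<^sub>F x in at_left 1. (\<Sum>n<N. b n * x ^ n) \<le> g x"
      using ev
    proof eventually_elim
      case (elim x)
      then show ?case
        using sums[OF elim] nonneg sum_le_suminf[of "\<lambda>n. b n * x ^ n" "{..<N}"]
        by (auto simp: sums_iff)
    qed
  qed (use lim in auto)
  then have summable: "summable b"
    using nonneg by (intro summableI_nonneg_bounded)
  moreover have "L \<le> suminf b"
  proof (rule tendsto_upperbound[OF lim])
    show "\<forall>\<^sub>F x in at_left 1. g x \<le> suminf b"
      using ev
    proof eventually_elim
      case (elim x)
      then have "b n * x ^ n \<le> b n" for n
        using nonneg by (intro mult_left_le power_le_one) auto
      then show ?case
        using sums[OF elim] summable suminf_le[of "\<lambda>n. b n * x ^ n" b] by (auto simp: sums_iff)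
    qed
  qed auto
  moreover have "suminf b \<le> L"
    using partial by (intro suminf_le_const summable)
  ultimately show ?thesis
    by (simp add: sums_iff)
qed

lemma powser_tendsto_0:
  fixes g :: "real \<Rightarrow> real"
  assumes "\<And>x. x \<in> {0<..<1} \<Longrightarrow> (\<lambda>n. b n * x ^ n) sums g x"
  shows "(g \<longlongrightarrow> b 0) (at_right 0)"
proof -
  have "summable (\<lambda>n. b n * (1/2) ^ n)"
    using assms[of "1/2"] by (simp add: sums_iff)
  then have "isCont (\<lambda>x. \<Sum>n. b n * x ^ n) 0"
    by (rule isCont_powser) simp
  then have "((\<lambda>x. \<Sum>n. b n * x ^ n) \<longlongrightarrow> b 0) (at_right 0)"
    by (simp add: isCont_def filterlim_at_split)
  moreover have "\<forall>\<^sub>F x in at_right 0. (\<Sum>n. b n * x ^ n) = g x"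
    using assms by (intro eventually_at_rightI[of 0 1]) (auto simp: sums_iff)
  ultimately show ?thesis
    by (rule Lim_transform_eventually)
qed

subsection \<open>The expansion of the Hardy weight\<close>

lemma hardy_weight_sums:
  assumes "p > 1" "q > 1" "x \<in> {0<..<1}"
  shows "(\<lambda>k. moment p q (2 * k) * x ^ (2 * k)) sums (1 / x powr p * hardy_weight p q (1 / x))"
proof -
  define s where "s = 1 / q"
  define c where "c n = Re ((deriv ^^ n) (hardy_fun s (p - 1)) 0 / fact n)" for n
  have s: "0 < s" "s < 1" using assms by (auto simp: s_def)
  have sums: "(\<lambda>n. c n * y ^ n) sums ((1 - (1 - y) powr s) / y) powr (p - 1)"
    if "\<bar>y\<bar> < 1" "y \<noteq> 0" for y
  proof -
    have "(\<lambda>n. (deriv ^^ n) (hardy_fun s (p - 1)) 0 / fact n * (of_real y - 0) ^ n)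
        sums hardy_fun s (p - 1) (of_real y)"
      using that by (intro holomorphic_power_series[OF hardy_fun_holomorphic_ball[OF s]]) auto
    from sums_Re[OF this] show ?thesis
      using that s hardy_fun_of_real[of y s "p - 1"]
      by (simp add: c_def del: times_divide_eq_left flip: of_real_power)
  qed
  let ?d = "((1 - (1 - x) powr s) / x) powr (p - 1) - ((1 - (1 + x) powr s) / (- x)) powr (p - 1)"
  \<comment> \<open>Even indices cancel and odd ones double.\<close>
  have "(\<lambda>n. (c n * x ^ n - c n * (- x) ^ n) / x) sums (?d / x)"
    using sums[of x] sums[of "- x"] assms(3) by (intro sums_divide sums_diff) auto
  also have "?d / x = 1 / x powr p * hardy_weight p q (1 / x)"
  proof -
    have eq: "(1 - (1 + x) powr s) / (- x) = ((1 + x) powr s - 1) / x"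
      using assms(3) by (simp add: field_simps)
    have "?d = ((1 - (1 - x) powr s) powr (p - 1) - ((1 + x) powr s - 1) powr (p - 1)) / x powr (p - 1)"
      unfolding eq powr_divide by (simp only: diff_divide_distrib)
    moreover have "x powr p = x powr (p - 1) * x"
      using assms(3) powr_add[of x "p - 1" 1] by simp
    ultimately show ?thesis
      by (simp add: hardy_weight_def s_def)
  qed
  finally have all_sums: "(\<lambda>n. (c n * x ^ n - c n * (- x) ^ n) / x)
      sums (1 / x powr p * hardy_weight p q (1 / x))" .
  have "(c n * x ^ n - c n * (- x) ^ n) / x = 0" if "n \<notin> range (\<lambda>k. 2 * k + 1)" for n
  proof -
    have "even n" using that by (metis oddE rangeI)
    then show ?thesis by simp
  qed
  then have "(\<lambda>k. (c (2 * k + 1) * x ^ (2 * k + 1) - c (2 * k + 1) * (- x) ^ (2 * k + 1)) / x)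
      sums (1 / x powr p * hardy_weight p q (1 / x))"
    using all_sums by (subst sums_mono_reindex[where g = "\<lambda>k. 2 * k + 1"]) (auto simp: strict_mono_def)
  \<comment> \<open>The doubling matches the factor 2 that \<open>moment_even\<close> gains from
    folding [-1, 1] onto [0, 1].\<close>
  moreover have "(c (2 * k + 1) * x ^ (2 * k + 1) - c (2 * k + 1) * (- x) ^ (2 * k + 1)) / x
      = moment p q (2 * k) * x ^ (2 * k)" for k
    using taylor_coeff_rho[OF assms(1,2), of "2 * k"] assms(3)
    by (simp add: moment_even[OF assms(1,2)] c_def s_def)
  ultimately show ?thesis by simp
qed

theorem corollary2:
  fixes p q :: real
  assumes "p > 1" and "q > 1" and "1 / p + 1 / q = 1"
  shows "absolutely_monotonic_01 (scaled_weight p q) \<and>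
    (\<forall>x\<in>{0<..1}. (\<lambda>k. moment p q (2 * k) * x ^ (2 * k)) sums
       (1 / x powr p * hardy_weight p q (1 / x))) \<and>
    (\<forall>k. moment p q (2 * k) > 0)"
proof -
  define f where "f x = 1 / x powr p * hardy_weight p q (1 / x)" for x
  \<comment> \<open>Zeros at odd indices turn the expansion into an ordinary power series.\<close>
  define b where "b n = (if even n then moment p q n else 0)" for n
  have pos: "moment p q (2 * k) > 0" for k
    using assms by (rule moment_even_pos)
  then have b_nonneg: "0 \<le> b n" for n
    by (auto simp: b_def less_imp_le elim!: evenE)
  have reindex: "(\<lambda>k. moment p q (2 * k) * x ^ (2 * k)) sums y \<longleftrightarrow> (\<lambda>n. b n * x ^ n) sums y" for x y
  proof -
    have "b n * x ^ n = 0" if "n \<notin> range ((*) 2)" for n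
      using that by (auto simp: b_def elim!: evenE)
    then have "(\<lambda>k. b (2 * k) * x ^ (2 * k)) sums y \<longleftrightarrow> (\<lambda>n. b n * x ^ n) sums y"
      by (intro sums_mono_reindex) (auto simp: strict_mono_def)
    then show ?thesis by (simp add: b_def)
  qed
  have f_sums: "(\<lambda>n. b n * x ^ n) sums f x" if "x \<in> {0<..<1}" for x
    using hardy_weight_sums[OF assms(1,2) that] by (simp add: reindex f_def)
  have f_cont: "continuous_on {0<..1} f"
  proof -
    \<comment> \<open>These bounds keep the bases of the outer powers nonnegative; where a base is
      0, continuity rests on the positive exponent.\<close>
    have le: "(1 - x) powr (1 / q) \<le> 1" "1 \<le> (1 + x) powr (1 / q)" if "x \<in> {0<..1}" for x
      using that assms(2) powr_mono2[of "1 / q" "1 - x" 1] by (auto simp: ge_one_powr_ge_zero)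
    have "continuous_on {0<..1} (\<lambda>x. 1 / x powr p *
        ((1 - (1 - x) powr (1 / q)) powr (p - 1) - ((1 + x) powr (1 / q) - 1) powr (p - 1)))"
      using assms(1,2) le
      by (intro continuous_on_mult continuous_on_divide continuous_on_diff continuous_on_add
          continuous_on_powr' continuous_on_const continuous_on_id) auto
    then show ?thesis
      by (simp add: f_def[abs_def] hardy_weight_def)
  qed
  have f_lim: "(f \<longlongrightarrow> b 0) (at_right 0)"
    using f_sums by (rule powser_tendsto_0)
  \<comment> \<open>The point 1 is the branch point, on the boundary of the disc of holomorphy, so
    the expansion there is reached as a limit from the left.\<close>
  have "b sums f 1"
  proof (rule powser_sums_at_1[OF f_sums b_nonneg])
    show "(f \<longlongrightarrow> f 1) (at_left 1)"
    proof (rule continuous_on_Icc_at_leftD)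
      show "continuous_on {1/2..1} f"
        using f_cont by (rule continuous_on_subset) auto
    qed simp
  qed
  then have sums: "(\<lambda>n. b n * x ^ n) sums f x" if "x \<in> {0<..1}" for x
    using that f_sums[of x] by (cases "x = 1") auto
  have weight: "scaled_weight p q x = f x" if "x \<noteq> 0" for x
    using that by (simp add: scaled_weight_def limit_at_zero_def f_def)
  have weight_0: "scaled_weight p q 0 = b 0"
    using tendsto_Lim[OF _ f_lim] by (simp add: scaled_weight_def limit_at_zero_def f_def[abs_def])
  have weight_sums: "(\<lambda>n. b n * x ^ n) sums scaled_weight p q x" if "x \<in> {0<..<1}" for x
    using sums[of x] that by (simp add: weight)
  have "continuous_on {0..1} (scaled_weight p q)"
  proof (rule continuous_on_Icc_at_rightI)
    show "continuous_on {0<..1} (scaled_weight p q)"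
      using f_cont by (rule continuous_on_eq) (simp add: weight)
    show "(scaled_weight p q \<longlongrightarrow> scaled_weight p q 0) (at_right 0)"
      unfolding weight_0 using weight_sums by (rule powser_tendsto_0)
  qed auto
  then have "absolutely_monotonic_01 (scaled_weight p q)"
    using powser_derivs_nonneg[OF weight_sums b_nonneg]
    by (simp add: absolutely_monotonic_01_def)
  then show ?thesis
    using sums pos by (auto simp: reindex f_def)
qed

end
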